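(* There are positive constants $a_3$ and $\kappa_3$ such that for every positive integer $R$ and every subset $V$ of $\mathbb{Z}^2$ containing $(0,0)$ and $(R,0)$, $$P_0\big(H(R,0)<H(V^c)\big)\ \le\ \exp\Big(a_3-\kappa_3\sqrt{\frac{R^3}{|V|}}\Big).$$
   Context: The comb lattice $\mathcal{C}$ is the graph with vertex set $\mathbb{Z}^2$ in which $(x,y)$ and $(x',y')$ are neighbors if either $x=x'$ and $|y-y'|=1$, or $y=y'=0$ and $|x-x'|=1$. $P_0$ is the law of the simple random walk on $\mathcal{C}$ (each step goes to a uniformly chosen neighbor) started at the origin. For $\Lambda\subset\mathbb{Z}^2$, $H(\Lambda)$ is the first time the walk hits $\Lambda$; $H(R,0)$ means $H(\{(R,0)\})$; $V^c=\mathbb{Z}^2\setminus V$; $|V|$ is the number of sites of $V$. *)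

theory Defs
  imports "HOL-Probability.Probability" "HOL-Library.Extended_Nat"
begin

type_synonym site = "int \<times> int"

definition comb_adj :: "site \<Rightarrow> site \<Rightarrow> bool" where
  "comb_adj p q \<longleftrightarrow>
     (fst p = fst q \<and> \<bar>snd p - snd q\<bar> = 1) \<or>
     (snd p = 0 \<and> snd q = 0 \<and> \<bar>fst p - fst q\<bar> = 1)"

lemma comb_nbrs:
  "{q. comb_adj (x, y) q} =
     (if y = 0 then {(x, 1), (x, -1), (x + 1, 0), (x - 1, 0)} else {(x, y + 1), (x, y - 1)})"
  by (auto simp: comb_adj_def split: if_splits)

lemma finite_comb_nbrs: "finite {q. comb_adj p q}"
  by (cases p) (simp add: comb_nbrs)

lemma comb_nbrs_nonempty: "{q. comb_adj p q} \<noteq> {}"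
  by (cases p) (simp add: comb_nbrs)

definition comb_step :: "site \<Rightarrow> site pmf" where
  "comb_step p = pmf_of_set {q. comb_adj p q}"

lemma pmf_comb_step:
  "pmf (comb_step p) q = (if comb_adj p q then 1 / real (card {r. comb_adj p r}) else 0)"
  unfolding comb_step_def
  by (subst pmf_of_set[OF comb_nbrs_nonempty finite_comb_nbrs]) (simp add: indicator_def)

text \<open>
  The kernel giving the conditional law of the position at time \<open>n\<close>, given the path
  \<open>\<omega>\<close> before time \<open>n\<close>, for the walk started at \<open>z\<close>.
\<close>
primrec srw_kernel :: "site \<Rightarrow> nat \<Rightarrow> (nat \<Rightarrow> site) \<Rightarrow> site measure" where
  "srw_kernel z 0 \<omega> = measure_pmf (return_pmf z)"
| "srw_kernel z (Suc n) \<omega> = measure_pmf (comb_step (\<omega> n))"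

lemma measurable_srw_kernel:
  "srw_kernel z n \<in> measurable (PiM {0..<n} (\<lambda>_. count_space UNIV)) (subprob_algebra (count_space UNIV))"
proof (cases n)
  case 0
  have "srw_kernel z 0 = (\<lambda>_. measure_pmf (return_pmf z))" by auto
  then show ?thesis
    using 0 by (simp add: space_subprob_algebra measure_pmf.subprob_space_axioms)
next
  case (Suc m)
  have "(\<lambda>\<omega>. \<omega> m) \<in> measurable (PiM {0..<n} (\<lambda>_. count_space (UNIV :: site set))) (count_space UNIV)"
    using Suc by (intro measurable_component_singleton) auto
  moreover have "(\<lambda>p. measure_pmf (comb_step p)) \<in> measurable (count_space UNIV) (subprob_algebra (count_space UNIV))"
    by (auto simp: space_subprob_algebra measure_pmf.subprob_space_axioms)
  ultimately have "(\<lambda>\<omega>. measure_pmf (comb_step (\<omega> m))) \<in>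
      measurable (PiM {0..<n} (\<lambda>_. count_space UNIV)) (subprob_algebra (count_space UNIV))"
    by (rule measurable_compose)
  moreover have "srw_kernel z n = (\<lambda>\<omega>. measure_pmf (comb_step (\<omega> m)))"
    using Suc by auto
  ultimately show ?thesis by simp
qed

lemma prob_space_srw_kernel: "prob_space (srw_kernel z n \<omega>)"
  by (cases n) (simp_all add: measure_pmf.prob_space_axioms)

interpretation SRW: Ionescu_Tulcea "srw_kernel z" "\<lambda>_. count_space UNIV" for z
  by (intro Ionescu_Tulcea.intro measurable_srw_kernel prob_space_srw_kernel)

text \<open>
  The law, on the space of infinite paths, of the simple random walk on the comb started
  at \<open>z\<close>, obtained from its one-step transitions by the Ionescu-Tulcea theorem;
  lemma \<open>prob_comb_srw_path\<close> below gives its finite-dimensional distributions.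
\<close>
definition comb_srw :: "site \<Rightarrow> (nat \<Rightarrow> site) measure" where
  "comb_srw z = SRW.PF.lim z"

text \<open>
  The first time \<open>n \<ge> 0\<close> at which the path is in \<open>A\<close>; it is \<open>\<infinity>\<close> if there is no such time,
  since the infimum of the empty set of \<open>enat\<close> is \<open>\<infinity>\<close>.
\<close>
definition hit :: "site set \<Rightarrow> (nat \<Rightarrow> site) \<Rightarrow> enat" where
  "hit A \<omega> = (INF n \<in> {n. \<omega> n \<in> A}. enat n)"

lemma space_comb_srw [simp]: "space (comb_srw z) = UNIV"
  by (simp add: comb_srw_def space_PiM PiE_def)

lemma sets_comb_srw [measurable_cong]:
  "sets (comb_srw z) = sets (PiM UNIV (\<lambda>_. count_space UNIV))"
  by (simp add: comb_srw_def)

lemma prob_space_comb_srw: "prob_space (comb_srw z)"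
proof (rule prob_spaceI)
  let ?M = "\<lambda>_ :: nat. count_space (UNIV :: site set)"
  have "emeasure (SRW.PF.lim z) (prod_emb UNIV ?M {} (space (PiM {} ?M))) =
      emeasure (SRW.CI z {}) (space (PiM {} ?M))"
    by (rule SRW.lim) auto
  also have "\<dots> = 1"
    using prob_space.emeasure_space_1[OF SRW.PF.prob_space_P[of "{}" z]]
    by (simp add: SRW.PF.space_P)
  also have "prod_emb UNIV ?M {} (space (PiM {} ?M)) = UNIV"
    by (auto simp: prod_emb_def space_PiM)
  finally show "emeasure (comb_srw z) (space (comb_srw z)) = 1"
    by (simp add: comb_srw_def space_PiM PiE_def)
qed

lemma emeasure_SRW_C:
  "emeasure (SRW.C z 0 n (\<lambda>_. undefined)) (PiE {0..<n} (\<lambda>i. {xs i})) =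
     (\<Prod>i<n. emeasure (srw_kernel z i xs) {xs i})"
proof (induction n)
  case 0
  show ?case by (simp add: emeasure_return sets_PiM_empty)
next
  case (Suc n)
  let ?M = "\<lambda>_ :: nat. count_space (UNIV :: site set)"
  let ?C = "SRW.C z 0 n (\<lambda>_. undefined)"
  let ?A = "\<lambda>n. PiE {0..<n} (\<lambda>i. {xs i})"
  have u: "(\<lambda>_. undefined) \<in> space (PiM {0..<0} ?M)"
    by (simp add: space_PiM)
  have A: "?A n \<in> sets (PiM {0..<n} ?M)" for n
    by (intro sets_PiM_I_finite) auto
  have spC: "space ?C = space (PiM {0..<n} ?M)" and seC: "sets ?C = sets (PiM {0..<n} ?M)"
    using SRW.space_C[OF u, of z n] SRW.sets_C[OF u, of z n] by simp_all
  have k: "emeasure (SRW.eP z n \<omega>) (?A (Suc n)) =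
      emeasure (srw_kernel z n xs) {xs n} * indicator (?A n) \<omega>" if "\<omega> \<in> space ?C" for \<omega>
  proof -
    have w: "\<omega> \<in> space (PiM {0..<n} ?M)" using that spC by simp
    have e: "fun_upd \<omega> n -` ?A (Suc n) \<inter> space (?M n) = (if \<omega> \<in> ?A n then {xs n} else {})"
      using w
      by (auto simp: space_PiM PiE_iff extensional_def less_Suc_eq split: if_splits)
    have "srw_kernel z n \<omega> = srw_kernel z n xs" if "\<omega> \<in> ?A n"
      using that by (cases n) (auto simp: PiE_iff)
    then show ?thesis
      unfolding SRW.emeasure_eP[OF w A] e by auto
  qed
  have "emeasure (SRW.C z 0 (Suc n) (\<lambda>_. undefined)) (?A (Suc n)) =
      (\<integral>\<^sup>+\<omega>. emeasure (SRW.eP z n \<omega>) (?A (Suc n)) \<partial>?C)"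
    using SRW.measurable_eP[of z n] A[of "Suc n"] spC
    by (simp add: space_PiM_empty_iff measurable_cong_sets[OF seC refl]
          emeasure_bind[where N = "PiM {0..<Suc n} ?M"])
  also have "\<dots> = (\<integral>\<^sup>+\<omega>. emeasure (srw_kernel z n xs) {xs n} * indicator (?A n) \<omega> \<partial>?C)"
    by (rule nn_integral_cong) (rule k)
  also have "\<dots> = emeasure (srw_kernel z n xs) {xs n} * emeasure ?C (?A n)"
    using A[of n] by (simp add: nn_integral_cmult_indicator seC)
  finally show ?case
    by (simp add: Suc.IH mult.commute)
qed

lemma prob_comb_srw_path:
  "\<P>(\<omega> in comb_srw z. \<forall>i\<le>n. \<omega> i = xs i) =
     of_bool (xs 0 = z) * (\<Prod>i<n. pmf (comb_step (xs i)) (xs (Suc i)))"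
proof -
  let ?M = "\<lambda>_ :: nat. count_space (UNIV :: site set)"
  let ?A = "PiE {0..<Suc n} (\<lambda>i. {xs i})"
  have A: "?A \<in> sets (PiM {0..<Suc n} ?M)"
    by (intro sets_PiM_I_finite) auto
  have "{\<omega>. \<forall>i\<le>n. \<omega> i = xs i} = prod_emb UNIV ?M {0..<Suc n} ?A"
    by (auto simp: prod_emb_def space_PiM PiE_iff less_Suc_eq_le)
  then have "emeasure (comb_srw z) {\<omega>. \<forall>i\<le>n. \<omega> i = xs i} = emeasure (SRW.CI z {0..<Suc n}) ?A"
    unfolding comb_srw_def using SRW.lim[OF _ A, of z] by simp
  also have "\<dots> = emeasure (SRW.C z 0 (Suc n) (\<lambda>_. undefined)) ?A"
    using SRW.emeasure_CI[OF order_refl A, of z] prod_emb_id[of ?A "{0..<Suc n}" ?M]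
      sets.sets_into_space[OF A] by (simp add: space_PiM)
  also have "\<dots> = (\<Prod>i<Suc n. emeasure (srw_kernel z i xs) {xs i})"
    by (rule emeasure_SRW_C)
  also have "\<dots> = ennreal (\<Prod>i<Suc n. measure (srw_kernel z i xs) {xs i})"
    by (simp add: finite_measure.emeasure_eq_measure
          [OF prob_space.finite_measure[OF prob_space_srw_kernel]] prod_ennreal
        del: prod.lessThan_Suc)
  also have "(\<Prod>i<Suc n. measure (srw_kernel z i xs) {xs i}) =
      of_bool (xs 0 = z) * (\<Prod>i<n. pmf (comb_step (xs i)) (xs (Suc i)))"
    unfolding prod.lessThan_Suc_shift by (simp add: measure_pmf_single)
  finally show ?thesis
    by (simp add: measure_def prod_nonneg)
qed

lemma hit_less_iff:
  "hit A \<omega> < hit B \<omega> \<longleftrightarrow> (\<exists>n. \<omega> n \<in> A \<and> (\<forall>m\<le>n. \<omega> m \<notin> B))"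
proof
  assume "hit A \<omega> < hit B \<omega>"
  then obtain n where n: "\<omega> n \<in> A" "enat n < hit B \<omega>"
    by (auto simp: hit_def INF_less_iff)
  have "\<omega> m \<notin> B" if "m \<le> n" for m
  proof
    assume "\<omega> m \<in> B"
    then have "hit B \<omega> \<le> enat m" unfolding hit_def by (intro INF_lower) simp
    with n(2) that show False by (meson enat_ord_simps(1) leD order_trans)
  qed
  with n(1) show "\<exists>n. \<omega> n \<in> A \<and> (\<forall>m\<le>n. \<omega> m \<notin> B)" by blast
next
  assume "\<exists>n. \<omega> n \<in> A \<and> (\<forall>m\<le>n. \<omega> m \<notin> B)"
  then obtain n where n: "\<omega> n \<in> A" "\<forall>m\<le>n. \<omega> m \<notin> B" by blast
  have "hit A \<omega> \<le> enat n" unfolding hit_def using n(1) by (intro INF_lower) simp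
  also have "enat n < enat (Suc n)" by simp
  also have "enat (Suc n) \<le> hit B \<omega>"
    unfolding hit_def using n(2) by (intro INF_greatest) (auto simp: not_less_eq_eq[symmetric])
  finally show "hit A \<omega> < hit B \<omega>" .
qed

lemma sets_hit_less: "{\<omega>. hit A \<omega> < hit B \<omega>} \<in> sets (comb_srw z)"
proof -
  have c [measurable]: "(\<lambda>\<omega>. \<omega> n) \<in> measurable (comb_srw z) (count_space UNIV)" for n
    using measurable_component_singleton[of n UNIV "\<lambda>_. count_space (UNIV :: site set)"]
    by (simp add: measurable_cong_sets[OF sets_comb_srw refl])
  have "{\<omega> \<in> space (comb_srw z). \<exists>n. \<omega> n \<in> A \<and> (\<forall>m\<le>n. \<omega> m \<notin> B)} \<in> sets (comb_srw z)"
    by measurable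
  then show ?thesis by (simp add: hit_less_iff)
qed

end

theory Submission
  imports Defs
begin

text \<open>
  Let \<open>n x\<close> be the number of sites in the connected piece of \<open>V\<close> around \<open>(x, 0)\<close> in column \<open>x\<close>.
  An excursion into a tooth of that column leaves \<open>V\<close> before it returns with probability one over
  the distance to the exit (gambler's ruin). So, seen only on the spine, the walk is a simple random
  walk killed at \<open>x\<close> at a rate of order at least \<open>1 / n x\<close>, while the sum of the \<open>n x\<close> over
  the spine is at most \<open>card V\<close>. Killing is least harmful if \<open>n\<close> is constant, of size
  \<open>card V / R\<close>; the killed walk then survives over distances of order \<open>sqrt (card V / R)\<close>, and
  reaching \<open>R\<close> costs a constant factor on each of about \<open>R / sqrt (card V / R)\<close>
  \<open>= sqrt (R ^ 3 / card V)\<close> stretches. This is the exponent.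

  The upper bound needs no stopping theorem for the killed walk, only a nonnegative function \<open>w\<close>
  that is at least \<open>1\<close> at the target and superharmonic at the other sites of \<open>V\<close>: then \<open>w\<close> at the
  start bounds the probability (\<open>prob_hit_before_exit_le\<close>). Such a \<open>w\<close> is written down explicitly.
  Along a tooth it decreases linearly to \<open>0\<close> at the exit, which turns superharmonicity on the spine
  into \<open>U (x - 1) + U (x + 1) \<le> (2 + k x) * U x\<close>, where \<open>k x\<close> is the sum of the two exit
  probabilities. The solution \<open>U\<close> of the equality that starts with \<open>U 0 = U 1 = 1\<close>, frozen to the
  left of \<open>0\<close> and to the right of \<open>R\<close> and divided by \<open>U R\<close>, gives the bound \<open>1 / U R\<close>
  (\<open>prob_hit_le_profile\<close>).

  There remains the growth of \<open>U\<close>. It is nondecreasing and convex, and summing the equation twice over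
  a block of \<open>L\<close> columns containing \<open>M\<close> sites gives a growth factor of at least
  \<open>exp (1 / 2 - M / L ^ 3)\<close> (\<open>spine_growth_block\<close>). The loss is linear in \<open>M\<close>, so multiplying over
  blocks only involves the total number of sites, however unevenly they are distributed over the
  blocks; with \<open>L\<close> a large enough multiple of \<open>sqrt (card V / R)\<close> half of the gain survives.
\<close>

section \<open>Superharmonic functions bound hitting probabilities\<close>

definition at_after :: "site set \<Rightarrow> nat \<Rightarrow> site \<Rightarrow> (nat \<Rightarrow> site) set" where
  "at_after S n x = {\<omega>. \<omega> n = x \<and> (\<forall>i<n. \<omega> i \<in> S)}"

lemma measurable_coordinate [measurable]:
  "(\<lambda>\<omega>. \<omega> n) \<in> measurable (comb_srw z) (count_space UNIV)"
  using measurable_component_singleton[of n UNIV "\<lambda>_. count_space (UNIV :: site set)"]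
  by (simp add: measurable_cong_sets[OF sets_comb_srw refl])

lemma sets_at_after [measurable]: "at_after S n x \<in> sets (comb_srw z)"
proof -
  have "{\<omega> \<in> space (comb_srw z). \<omega> n = x \<and> (\<forall>i<n. \<omega> i \<in> S)} \<in> sets (comb_srw z)"
    by measurable
  then show ?thesis by (simp add: at_after_def)
qed

lemma sets_path [measurable]: "{\<omega>. \<forall>i\<le>n::nat. \<omega> i = xs i} \<in> sets (comb_srw z)"
proof -
  have "{\<omega> \<in> space (comb_srw z). \<forall>i\<le>n. \<omega> i = xs i} \<in> sets (comb_srw z)"
    by measurable
  then show ?thesis by simp
qed

lemma measure_path:
  "measure (comb_srw z) {\<omega>. \<forall>i\<le>n. \<omega> i = xs i} =
     of_bool (xs 0 = z) * (\<Prod>i<n. pmf (comb_step (xs i)) (xs (Suc i)))"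
  using prob_comb_srw_path[of z n xs] by simp

text \<open>
  The Markov property at time \<open>n\<close>. Finiteness of \<open>S\<close> makes the event a finite disjoint union of
  events that prescribe the whole path up to time \<open>n\<close>, whose probabilities are known.
\<close>
lemma measure_at_after_step:
  assumes "finite S"
  shows "measure (comb_srw z) (at_after S n x \<inter> {\<omega>. \<omega> (Suc n) = q}) =
    measure (comb_srw z) (at_after S n x) * pmf (comb_step x) q"
proof -
  interpret prob_space "comb_srw z" by (rule prob_space_comb_srw)
  let ?X = "PiE {..n} (\<lambda>i. if i < n then S else {x})"
  let ?c = "\<lambda>xs. {\<omega> :: nat \<Rightarrow> site. \<forall>i\<le>n. \<omega> i = xs i}"
  let ?d = "\<lambda>xs. {\<omega> :: nat \<Rightarrow> site. \<forall>i\<le>Suc n. \<omega> i = (xs(Suc n := q)) i}"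
  have fin: "finite ?X" using assms by (intro finite_PiE) auto
  have eq: "xs = restrict \<omega> {..n}" if "xs \<in> ?X" "\<forall>i\<le>n. \<omega> i = xs i" for xs \<omega>
    using that by (auto simp: PiE_iff extensional_def restrict_def fun_eq_iff)
  have disj: "disjoint_family_on ?c ?X"
    unfolding disjoint_family_on_def using eq by (auto, metis+)
  have dc: "?d xs = ?c xs \<inter> {\<omega>. \<omega> (Suc n) = q}" for xs
    by (auto simp: le_Suc_eq)
  have disj': "disjoint_family_on ?d ?X"
    unfolding dc using disj by (auto simp: disjoint_family_on_def)
  have A: "at_after S n x = (\<Union>xs\<in>?X. ?c xs)"
  proof (intro equalityI subsetI)
    fix \<omega> assume "\<omega> \<in> at_after S n x"
    then have "restrict \<omega> {..n} \<in> ?X" "\<omega> \<in> ?c (restrict \<omega> {..n})"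
      by (auto simp: at_after_def PiE_iff)
    then show "\<omega> \<in> (\<Union>xs\<in>?X. ?c xs)" by blast
  next
    fix \<omega> assume "\<omega> \<in> (\<Union>xs\<in>?X. ?c xs)"
    then show "\<omega> \<in> at_after S n x"
      by (auto simp: at_after_def PiE_iff split: if_splits)
  qed
  have B: "at_after S n x \<inter> {\<omega>. \<omega> (Suc n) = q} = (\<Union>xs\<in>?X. ?d xs)"
    unfolding A dc by blast
  have "measure (comb_srw z) (\<Union>xs\<in>?X. ?d xs) = (\<Sum>xs\<in>?X. measure (comb_srw z) (?d xs))"
    by (rule finite_measure_finite_Union[OF fin _ disj']) (use sets_path in blast)
  also have "\<dots> = (\<Sum>xs\<in>?X. measure (comb_srw z) (?c xs) * pmf (comb_step x) q)"
    by (intro sum.cong refl, subst (1 2) measure_path) (auto simp: PiE_iff split: if_splits)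
  also have "\<dots> = measure (comb_srw z) (\<Union>xs\<in>?X. ?c xs) * pmf (comb_step x) q"
    unfolding sum_distrib_right[symmetric]
    by (subst finite_measure_finite_Union[OF fin _ disj]) (use sets_path in blast)+
  finally show ?thesis unfolding A[symmetric] B[symmetric] .
qed

lemma measure_at_after_Suc:
  assumes "finite S"
  shows "measure (comb_srw z) (at_after S (Suc n) q) =
    (\<Sum>x\<in>S. measure (comb_srw z) (at_after S n x) * pmf (comb_step x) q)"
proof -
  interpret prob_space "comb_srw z" by (rule prob_space_comb_srw)
  have eq: "at_after S (Suc n) q = (\<Union>x\<in>S. at_after S n x \<inter> {\<omega>. \<omega> (Suc n) = q})"
    by (auto simp: at_after_def less_Suc_eq)
  have m: "at_after S n x \<inter> {\<omega>. \<omega> (Suc n) = q} \<in> sets (comb_srw z)" for x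
  proof -
    have "{\<omega> \<in> space (comb_srw z). \<omega> (Suc n) = q} \<in> sets (comb_srw z)" by measurable
    then show ?thesis using sets_at_after by auto
  qed
  have "disjoint_family_on (\<lambda>x. at_after S n x \<inter> {\<omega>. \<omega> (Suc n) = q}) S"
    by (auto simp: disjoint_family_on_def at_after_def)
  from finite_measure_finite_Union[OF assms _ this] m show ?thesis
    unfolding eq by (simp add: measure_at_after_step[OF assms] image_subset_iff)
qed

lemma measure_at_after_0:
  "measure (comb_srw z) (at_after S 0 x) = of_bool (x = z)"
  using measure_path[of z 0 "\<lambda>_. x"] by (simp add: at_after_def)

text \<open>
  The mean of \<open>w\<close> over the walks that are still inside \<open>V\<close> and have not met \<open>t\<close> does not increase in
  time, and at each step it drops by at least the probability of arriving at \<open>t\<close> at that step,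
  because \<open>w t\<close> is at least \<open>1\<close>. Hence all the arrival probabilities together are at most the
  initial value \<open>w z\<close>.
\<close>
lemma prob_hit_before_exit_le:
  fixes w :: "site \<Rightarrow> real"
  assumes fin: "finite V" and zV: "z \<in> V" and nonneg: "\<And>p. 0 \<le> w p" and target: "1 \<le> w t"
    and super: "\<And>p. p \<in> V \<Longrightarrow> p \<noteq> t \<Longrightarrow>
      (\<Sum>q | comb_adj p q. w q) \<le> real (card {q. comb_adj p q}) * w p"
  shows "\<P>(\<omega> in comb_srw z. hit {t} \<omega> < hit (- V) \<omega>) \<le> w z"
proof -
  interpret prob_space "comb_srw z" by (rule prob_space_comb_srw)
  define S where "S = V - {t}"
  define \<mu> where "\<mu> n x = measure (comb_srw z) (at_after S n x)" for n x
  have finS: "finite S" and tS: "t \<notin> S" using fin by (auto simp: S_def)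
  have \<mu>0: "0 \<le> \<mu> n x" for n x by (simp add: \<mu>_def)
  have step: "(\<Sum>q\<in>insert t S. pmf (comb_step x) q * w q) \<le> w x" if "x \<in> S" for x
  proof -
    let ?N = "{q. comb_adj x q}"
    have "(\<Sum>q\<in>insert t S. pmf (comb_step x) q * w q) =
        (\<Sum>q\<in>insert t S \<inter> ?N. w q / real (card ?N))"
      using finS by (simp add: pmf_comb_step sum.inter_restrict if_distrib cong: if_cong)
        (intro sum.mono_neutral_cong_right arg_cong2[of _ _ _ _ "(+)"]; auto)
    also have "\<dots> \<le> (\<Sum>q\<in>?N. w q / real (card ?N))"
      by (intro sum_mono2 finite_comb_nbrs) (auto simp: nonneg)
    also have "\<dots> = (\<Sum>q\<in>?N. w q) / real (card ?N)"
      by (simp add: sum_divide_distrib)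
    also have "\<dots> \<le> w x"
      using super[of x] that finite_comb_nbrs[of x] comb_nbrs_nonempty[of x]
      by (subst pos_divide_le_eq) (auto simp: S_def card_gt_0_iff mult.commute)
    finally show ?thesis .
  qed
  have decrease: "(\<Sum>q\<in>insert t S. \<mu> (Suc n) q * w q) \<le> (\<Sum>x\<in>S. \<mu> n x * w x)" for n
  proof -
    have "(\<Sum>q\<in>insert t S. \<mu> (Suc n) q * w q) =
        (\<Sum>q\<in>insert t S. \<Sum>x\<in>S. \<mu> n x * pmf (comb_step x) q * w q)"
      by (simp only: \<mu>_def measure_at_after_Suc[OF finS] sum_distrib_right)
    also have "\<dots> = (\<Sum>x\<in>S. \<Sum>q\<in>insert t S. \<mu> n x * pmf (comb_step x) q * w q)"
      by (rule sum.swap)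
    also have "\<dots> = (\<Sum>x\<in>S. \<mu> n x * (\<Sum>q\<in>insert t S. pmf (comb_step x) q * w q))"
      by (simp only: sum_distrib_left mult.assoc)
    also have "\<dots> \<le> (\<Sum>x\<in>S. \<mu> n x * w x)"
      by (intro sum_mono mult_left_mono step \<mu>0)
    finally show ?thesis .
  qed
  \<comment> \<open>arrivals so far plus the mean of \<open>w\<close> over the surviving walks\<close>
  have partial: "(\<Sum>m\<le>n. \<mu> m t) + (\<Sum>x\<in>S. \<mu> n x * w x) \<le> w z" for n
  proof (induction n)
    case 0
    have "\<mu> 0 x * w x = (if x = z then w x else 0)" for x
      by (simp add: \<mu>_def measure_at_after_0)
    then have "(\<Sum>x\<in>S. \<mu> 0 x * w x) = (if z \<in> S then w z else 0)"
      using finS by simp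
    moreover have "\<mu> 0 t = of_bool (t = z)" by (simp add: \<mu>_def measure_at_after_0)
    ultimately show ?case using zV target tS by (auto simp: S_def)
  next
    case (Suc n)
    have "\<mu> (Suc n) t \<le> \<mu> (Suc n) t * w t"
      using mult_left_mono[OF target \<mu>0] by simp
    with decrease[of n] finS tS Suc show ?case by simp
  qed
  have "(\<Sum>x\<in>S. \<mu> n x * w x) \<ge> 0" for n
    by (intro sum_nonneg mult_nonneg_nonneg \<mu>0 nonneg)
  with partial have "(\<Sum>m\<le>n. \<mu> m t) \<le> w z" for n
    by (metis add_increasing2 order_refl order_trans)
  then have bound: "(\<Sum>m<n. \<mu> m t) \<le> w z" for n
    using nonneg[of z] by (cases n) (simp_all add: lessThan_Suc_atMost del: sum.lessThan_Suc)
  have summ: "summable (\<lambda>m. \<mu> m t)"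
    by (rule summableI_nonneg_bounded[OF \<mu>0 bound])
  have "{\<omega>. hit {t} \<omega> < hit (- V) \<omega>} \<subseteq> (\<Union>m. at_after S m t)"
  proof
    fix \<omega> assume "\<omega> \<in> {\<omega>. hit {t} \<omega> < hit (- V) \<omega>}"
    then obtain n where n: "\<omega> n = t" "\<forall>m\<le>n. \<omega> m \<in> V" by (auto simp: hit_less_iff)
    define m where "m = (LEAST m. \<omega> m = t)"
    have "\<omega> m = t" "m \<le> n" "\<And>i. i < m \<Longrightarrow> \<omega> i \<noteq> t"
      using n(1) by (auto simp: m_def intro: LeastI Least_le dest: not_less_Least)
    with n(2) have "\<omega> \<in> at_after S m t" by (auto simp: at_after_def S_def)
    then show "\<omega> \<in> (\<Union>m. at_after S m t)" by blast
  qed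
  then have "prob {\<omega>. hit {t} \<omega> < hit (- V) \<omega>} \<le> prob (\<Union>m. at_after S m t)"
    by (intro finite_measure_mono) auto
  also have "\<dots> \<le> (\<Sum>m. \<mu> m t)"
    unfolding \<mu>_def
    by (rule finite_measure_subadditive_countably) (use summ in \<open>auto simp: \<mu>_def\<close>)
  also have "\<dots> \<le> w z"
    by (rule suminf_le_const[OF summ bound])
  finally show ?thesis by simp
qed

section \<open>Growth of solutions of the spine equation\<close>

text \<open>
  The two initial values make the discrete derivative at \<open>0\<close> vanish, so that the solution can be
  continued by the constant \<open>1\<close> to the left of the origin.
\<close>
fun spine_growth :: "(nat \<Rightarrow> real) \<Rightarrow> nat \<Rightarrow> real" where
  "spine_growth k 0 = 1"
| "spine_growth k (Suc 0) = 1"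
| "spine_growth k (Suc (Suc n)) = (2 + k (Suc n)) * spine_growth k (Suc n) - spine_growth k n"

context
  fixes k :: "nat \<Rightarrow> real"
  assumes k_nonneg: "\<And>n. 0 \<le> k n"
begin

lemma spine_growth_Suc: "1 \<le> spine_growth k n \<and> spine_growth k n \<le> spine_growth k (Suc n)"
proof (induction n)
  case (Suc n)
  then have "0 \<le> k (Suc n) * spine_growth k (Suc n)"
    using k_nonneg[of "Suc n"] by (intro mult_nonneg_nonneg) auto
  with Suc show ?case by (simp add: algebra_simps)
qed simp

lemma spine_growth_ge_1: "1 \<le> spine_growth k n"
  using spine_growth_Suc by blast

lemma spine_growth_mono: "m \<le> n \<Longrightarrow> spine_growth k m \<le> spine_growth k n"
  by (rule lift_Suc_mono_le[of "spine_growth k"]) (use spine_growth_Suc in auto)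

text \<open>
  The equation says that the increment grows by \<open>k\<close> times the current value at each step. In a
  stretch that starts at \<open>a\<close> the current value is at least the value at \<open>a\<close>.
\<close>
lemma spine_growth_increment:
  "spine_growth k a * (\<Sum>l=1..i. k (a + l)) \<le> spine_growth k (Suc (a + i)) - spine_growth k (a + i)"
proof (induction i)
  case 0
  then show ?case using spine_growth_Suc[of a] by simp
next
  case (Suc i)
  have "spine_growth k a * k (Suc (a + i)) \<le> spine_growth k (Suc (a + i)) * k (Suc (a + i))"
    using k_nonneg by (intro mult_right_mono spine_growth_mono) auto
  moreover have "spine_growth k (Suc (Suc n)) - spine_growth k (Suc n) =
      (spine_growth k (Suc n) - spine_growth k n) + spine_growth k (Suc n) * k (Suc n)" for n
    by (simp add: algebra_simps)
  from this[of "a + i"]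
  have "spine_growth k (Suc (a + Suc i)) - spine_growth k (a + Suc i) =
      (spine_growth k (Suc (a + i)) - spine_growth k (a + i)) +
      spine_growth k (Suc (a + i)) * k (Suc (a + i))"
    by (simp del: spine_growth.simps)
  ultimately show ?case using Suc by (simp del: spine_growth.simps add: distrib_left)
qed

lemma spine_growth_double_sum:
  "spine_growth k a * (1 + (\<Sum>i<j. \<Sum>l=1..i. k (a + l))) \<le> spine_growth k (a + j)"
proof (induction j)
  case (Suc j)
  with spine_growth_increment[of a j] show ?case
    by (simp add: algebra_simps)
qed simp

text \<open>
  Here \<open>c\<close> is a column size. The convex function \<open>2 / c\<close> lies above its tangent at \<open>c = L ^ 2\<close>,
  the column size for which a walk killed at rate \<open>1 / c\<close> survives over a distance of order \<open>L\<close>.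
  With the tangent in place of \<open>2 / c\<close>, the double sum of the previous lemma becomes affine in the
  total size of the block. The factor \<open>1 / 2\<close> in the exponent pays for replacing \<open>1 + y\<close> by an
  exponential when \<open>y\<close> is in the unit interval; for negative \<open>y\<close> monotonicity is enough.
\<close>
lemma spine_growth_block:
  fixes c :: "nat \<Rightarrow> real" and L :: nat
  assumes L: "2 \<le> L" and c: "\<And>l. 1 \<le> l \<Longrightarrow> l < L \<Longrightarrow> 2 / c (a + l) \<le> k (a + l)"
    and c_pos: "\<And>l. l < L \<Longrightarrow> 0 < c (a + l)"
  shows "spine_growth k a * exp ((1 - 2 * (\<Sum>l<L. c (a + l)) / real L ^ 3) / 2) \<le>
    spine_growth k (a + L)"
proof -
  let ?l = "real L" and ?M = "\<Sum>l<L. c (a + l)"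
  define y where "y = 1 - 2 * ?M / ?l ^ 3"
  have l: "?l \<ge> 2" using L by simp
  have M: "0 \<le> ?M" using c_pos by (intro sum_nonneg) (auto intro: less_imp_le)
  have tangent: "4 / ?l ^ 2 - 2 * c (a + i) / ?l ^ 4 \<le> k (a + i)" if "1 \<le> i" "i < L" for i
  proof -
    have p: "0 < c (a + i)" using c_pos that by simp
    have "2 / c (a + i) - (4 / ?l ^ 2 - 2 * c (a + i) / ?l ^ 4) =
        2 * (1 - c (a + i) / ?l ^ 2) ^ 2 / c (a + i)"
      using p l by (simp add: field_simps power2_eq_square power4_eq_xxxx)
    also have "\<dots> \<ge> 0" using p by simp
    finally show ?thesis using c[OF that] by simp
  qed
  have inner: "4 * real i / ?l ^ 2 - 2 * ?M / ?l ^ 4 \<le> (\<Sum>j=1..i. k (a + j))" if "i < L" for i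
  proof -
    have "(\<Sum>j=1..i. c (a + j)) \<le> ?M"
      using that c_pos by (intro sum_mono2) (auto intro: less_imp_le)
    then have "2 * (\<Sum>j=1..i. c (a + j)) / ?l ^ 4 \<le> 2 * ?M / ?l ^ 4"
      by (intro divide_right_mono) auto
    then have "4 * real i / ?l ^ 2 - 2 * ?M / ?l ^ 4 \<le>
        (\<Sum>j=1..i. 4 / ?l ^ 2 - 2 * c (a + j) / ?l ^ 4)"
      by (simp add: sum_subtractf sum_divide_distrib[symmetric] sum_distrib_left[symmetric]
          mult.commute[of 4 "real i"])
    also have "\<dots> \<le> (\<Sum>j=1..i. k (a + j))"
      using that by (intro sum_mono tangent) auto
    finally show ?thesis .
  qed
  have gauss: "(\<Sum>i<L. real i) = ?l * (?l - 1) / 2"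
    by (induction L) (auto simp: field_simps)
  have "y \<le> 2 * (?l - 1) / ?l - 2 * ?M / ?l ^ 3"
    using l by (simp add: y_def field_simps)
  also have "\<dots> = 4 * (?l * (?l - 1) / 2) / ?l ^ 2 - ?l * (2 * ?M / ?l ^ 4)"
    using l by (simp add: power2_eq_square power3_eq_cube power4_eq_xxxx divide_simps)
  also have "\<dots> = (\<Sum>i<L. 4 * real i / ?l ^ 2 - 2 * ?M / ?l ^ 4)"
    by (simp add: gauss[symmetric] sum_subtractf sum_divide_distrib[symmetric]
        sum_distrib_left[symmetric])
  also have "\<dots> \<le> (\<Sum>i<L. \<Sum>j=1..i. k (a + j))"
    by (intro sum_mono inner) auto
  finally have y: "y \<le> (\<Sum>i<L. \<Sum>j=1..i. k (a + j))" .
  have "exp (y / 2) \<le> 1 + max 0 y"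
  proof (cases "0 \<le> y")
    case True
    have y1: "y \<le> 1" using M by (simp add: y_def)
    have "exp (y / 2) \<le> 1 + y / 2 + (y / 2)\<^sup>2"
      using True y1 by (intro exp_bound) auto
    also have "(y / 2)\<^sup>2 \<le> y / 2"
      using True y1 mult_left_mono[of y 1 y] by (simp add: power2_eq_square)
    finally show ?thesis using True by simp
  qed simp
  also have "\<dots> \<le> 1 + (\<Sum>i<L. \<Sum>j=1..i. k (a + j))"
    using y by (auto intro!: sum_nonneg k_nonneg)
  finally have "spine_growth k a * exp (y / 2) \<le>
      spine_growth k a * (1 + (\<Sum>i<L. \<Sum>j=1..i. k (a + j)))"
    using spine_growth_ge_1[of a] by (intro mult_left_mono) auto
  also have "\<dots> \<le> spine_growth k (a + L)" by (rule spine_growth_double_sum)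
  finally show ?thesis by (simp add: y_def)
qed

lemma spine_growth_blocks:
  fixes c :: "nat \<Rightarrow> real" and L N :: nat
  assumes L: "2 \<le> L" and c: "\<And>i. i < N * L \<Longrightarrow> 2 / c i \<le> k i"
    and c_pos: "\<And>i. i < N * L \<Longrightarrow> 0 < c i"
  shows "exp (real N / 2 - (\<Sum>i<N * L. c i) / real L ^ 3) \<le> spine_growth k (N * L)"
  using c c_pos
proof (induction N)
  case (Suc N)
  let ?a = "N * L"
  have idx: "?a + l < Suc N * L" if "l < L" for l using that by simp
  have "{..<Suc N * L} = {..<?a} \<union> {?a..<?a + L}" by auto
  then have "(\<Sum>i<Suc N * L. c i) = (\<Sum>i<?a. c i) + (\<Sum>i=?a..<?a + L. c i)"
    by (simp add: sum.union_disjoint ivl_disj_int)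
  also have "(\<Sum>i=?a..<?a + L. c i) = (\<Sum>l<L. c (?a + l))"
    using sum.shift_bounds_nat_ivl[of c 0 ?a L] by (simp add: add.commute lessThan_atLeast0)
  finally have split: "(\<Sum>i<Suc N * L. c i) = (\<Sum>i<?a. c i) + (\<Sum>l<L. c (?a + l))" .
  have "exp (real (Suc N) / 2 - (\<Sum>i<Suc N * L. c i) / real L ^ 3) =
      exp (real N / 2 - (\<Sum>i<?a. c i) / real L ^ 3) *
      exp ((1 - 2 * (\<Sum>l<L. c (?a + l)) / real L ^ 3) / 2)"
    unfolding split exp_add[symmetric]
    by (simp add: add_divide_distrib diff_divide_distrib)
  also have "\<dots> \<le> spine_growth k ?a * exp ((1 - 2 * (\<Sum>l<L. c (?a + l)) / real L ^ 3) / 2)"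
    using Suc by (intro mult_right_mono Suc.IH) auto
  also have "\<dots> \<le> spine_growth k (?a + L)"
    using Suc.prems idx by (intro spine_growth_block L) auto
  finally show ?case by (simp add: add.commute)
qed simp

end

section \<open>The superharmonic function of a finite domain\<close>

text \<open>
  The number of sites of \<open>V\<close> that follow \<open>(x, 0)\<close> without a gap in the upward (\<open>s = 1\<close>) or downward
  (\<open>s = -1\<close>) direction. The site \<open>(x, 0)\<close> itself is not inspected.
\<close>
definition arm :: "site set \<Rightarrow> int \<Rightarrow> int \<Rightarrow> nat" where
  "arm V s x = (LEAST h. (x, s * (int h + 1)) \<notin> V)"

text \<open>
  A walk that steps from the spine into a tooth leaves \<open>V\<close> before it is back on the spine with
  probability one over the arm length plus one; the two directions are added.
\<close>
definition leak :: "site set \<Rightarrow> int \<Rightarrow> real" where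
  "leak V x = 1 / (real (arm V 1 x) + 1) + 1 / (real (arm V (-1) x) + 1)"

lemma arm_exit:
  assumes "finite V" "s \<noteq> 0"
  shows "(x, s * (int (arm V s x) + 1)) \<notin> V"
proof -
  have "inj (\<lambda>h. (x, s * (int h + 1)))" using assms(2) by (auto simp: inj_def)
  then have "infinite (range (\<lambda>h. (x, s * (int h + 1))))" by (rule range_inj_infinite)
  then have "\<not> range (\<lambda>h. (x, s * (int h + 1))) \<subseteq> V"
    using assms(1) by (meson finite_subset)
  then obtain h where "(x, s * (int h + 1)) \<notin> V" by blast
  then show ?thesis unfolding arm_def by (rule LeastI)
qed

lemma arm_inside:
  assumes "0 < j" "j \<le> int (arm V s x)"
  shows "(x, s * j) \<in> V"
proof -
  have "nat (j - 1) < (LEAST h. (x, s * (int h + 1)) \<notin> V)"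
    using assms unfolding arm_def by linarith
  from not_less_Least[OF this] assms(1) show ?thesis by simp
qed

lemma leak_nonneg: "0 \<le> leak V x"
  by (simp add: leak_def)

lemma leak_ge: "2 / (real (arm V 1 x) + real (arm V (-1) x) + 1) \<le> leak V x"
proof -
  have "2 / (p + q + 1) \<le> 1 / (p + 1) + 1 / (q + 1)" if "0 \<le> p" "0 \<le> q" for p q :: real
  proof -
    have "1 / (p + 1) + 1 / (q + 1) - 2 / (p + q + 1) = (p * p + q * q + p + q) / ((p + 1) * (q + 1) * (p + q + 1))"
      using that by (simp add: divide_simps) (simp add: algebra_simps)
    also have "\<dots> \<ge> 0" using that by simp
    finally show ?thesis by simp
  qed
  then show ?thesis by (simp add: leak_def)
qed

text \<open>The two arms and the spine site form disjoint pieces of \<open>V\<close> in distinct columns.\<close>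
lemma sum_arms_le_card:
  assumes fin: "finite V" and spine: "\<And>i. i < n \<Longrightarrow> (int i, 0) \<in> V"
  shows "(\<Sum>i<n. real (arm V 1 (int i)) + real (arm V (-1) (int i)) + 1) \<le> real (card V)"
proof -
  let ?Y = "\<lambda>i. {- int (arm V (-1) (int i))..int (arm V 1 (int i))}"
  have sub: "(\<lambda>(i, y). (int i, y)) ` (SIGMA i:{..<n}. ?Y i) \<subseteq> V"
  proof safe
    fix i y assume "i < n" "y \<in> ?Y i"
    then show "(int i, y) \<in> V"
      using spine[of i] arm_inside[of y V 1 "int i"] arm_inside[of "- y" V "-1" "int i"]
      by (cases y "0 :: int" rule: linorder_cases) auto
  qed
  have "inj_on (\<lambda>(i, y). (int i, y)) (SIGMA i:{..<n}. ?Y i)" by (auto simp: inj_on_def)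
  then have "card (SIGMA i:{..<n}. ?Y i) \<le> card V"
    by (rule card_inj_on_le[OF _ sub fin])
  then have "(\<Sum>i<n. card (?Y i)) \<le> card V" by simp
  then have "real (\<Sum>i<n. card (?Y i)) \<le> real (card V)" by (rule of_nat_mono)
  moreover have "real (card (?Y i)) = real (arm V 1 (int i)) + real (arm V (-1) (int i)) + 1" for i
    by simp
  ultimately show ?thesis by (simp only: of_nat_sum)
qed

text \<open>
  The probability that a walk started in a tooth reaches the spine before it leaves \<open>V\<close>. On the
  spine the value is \<open>1\<close>, since the numerator vanishes there whatever the arm in direction
  \<open>sgn 0 = 0\<close> is. Sites of \<open>V\<close> beyond the first gap get the value \<open>0\<close>.
\<close>
definition tooth :: "site set \<Rightarrow> site \<Rightarrow> real" where
  "tooth V p = max 0 (1 - \<bar>real_of_int (snd p)\<bar> / (real (arm V (sgn (snd p)) (fst p)) + 1))"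

text \<open>
  Constant to the left of \<open>0\<close> (where \<open>nat\<close> truncates) and to the right of the target \<open>R\<close>, where
  its value is \<open>1\<close>.
\<close>
definition profile :: "site set \<Rightarrow> nat \<Rightarrow> int \<Rightarrow> real" where
  "profile V R x = spine_growth (\<lambda>i. leak V (int i)) (min (nat x) R) /
    spine_growth (\<lambda>i. leak V (int i)) R"

lemma profile_nonneg: "0 \<le> profile V R x"
proof -
  have "1 \<le> spine_growth (\<lambda>i. leak V (int i)) n" for n
    by (rule spine_growth_ge_1[OF leak_nonneg])
  then have "0 \<le> spine_growth (\<lambda>i. leak V (int i)) n" for n
    by (rule order_trans[OF zero_le_one])
  then show ?thesis by (simp add: profile_def)
qed

text \<open>
  Strictly between \<open>0\<close> and \<open>R\<close> this is the recursion behind the profile, with equality. To the left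
  and to the right the three values agree, and so they do at \<open>0\<close> because of the two equal initial
  values; there a nonnegative leak suffices.
\<close>
lemma profile_super:
  assumes "x \<noteq> int R"
  shows "profile V R (x - 1) + profile V R (x + 1) \<le> (2 + leak V x) * profile V R x"
proof -
  let ?U = "spine_growth (\<lambda>i. leak V (int i))"
  have R: "1 \<le> ?U R" by (rule spine_growth_ge_1[OF leak_nonneg])
  have l: "0 \<le> leak V x" by (rule leak_nonneg)
  have flat: ?thesis if "profile V R (x - 1) = profile V R x" "profile V R (x + 1) = profile V R x"
    using that l profile_nonneg[of V R x] by (simp add: algebra_simps)
  consider "x < 0" | "x = 0" | "0 < x" "x < int R" | "x > int R" using assms by linarith
  then show ?thesis
  proof cases
    case 1
    then show ?thesis by (intro flat) (auto simp: profile_def)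
  next
    case 2
    then have "R \<ge> 1" using assms by simp
    with 2 show ?thesis by (intro flat) (auto simp: profile_def min_def)
  next
    case 3
    then obtain m where m: "x = int (Suc m)" using zero_less_imp_eq_int[of x] gr0_conv_Suc by auto
    with 3 have "min (nat (x - 1)) R = m" "min (nat x) R = Suc m" "min (nat (x + 1)) R = Suc (Suc m)"
      by auto
    then show ?thesis using R m by (simp add: profile_def field_simps)
  next
    case 4
    then have "min (nat (x - 1)) R = R" "min (nat x) R = R" "min (nat (x + 1)) R = R" by auto
    then show ?thesis by (intro flat) (simp_all add: profile_def)
  qed
qed

text \<open>
  Linear up to the exit and zero from there on. The only convex corner is at the exit, and the exit
  is not a site of \<open>V\<close>.
\<close>
lemma tooth_super:
  assumes fin: "finite V" and p: "(x, y) \<in> V" and y: "y \<noteq> 0"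
  shows "tooth V (x, y + 1) + tooth V (x, y - 1) \<le> 2 * tooth V (x, y)"
proof -
  define s where "s = sgn y"
  define j where "j = \<bar>y\<bar>"
  define h where "h = real (arm V s x) + 1"
  have h: "h \<ge> 1" by (simp add: h_def)
  have s: "s = 1 \<or> s = -1" using y by (auto simp: s_def sgn_if)
  have ysj: "y = s * j" and j: "j \<ge> 1" using y by (auto simp: s_def j_def sgn_if)
  have t: "tooth V (x, s * i) = max 0 (1 - real_of_int i / h)" if "i \<ge> 0" for i
    using that s h by (cases "i = 0") (auto simp: tooth_def h_def sgn_if)
  have exit: "j \<noteq> int (arm V s x) + 1"
    using arm_exit[OF fin, of s x] p ysj s by auto
  have conv: "max 0 (1 - (real_of_int j + 1) / h) + max 0 (1 - (real_of_int j - 1) / h)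
      \<le> 2 * max 0 (1 - real_of_int j / h)"
  proof (cases "j \<le> int (arm V s x)")
    case True
    then have "real_of_int j + 1 \<le> h" by (simp add: h_def)
    then show ?thesis using h by (simp add: field_simps max_def)
  next
    case False
    with exit have "real_of_int j - 1 \<ge> h" by (simp add: h_def)
    then show ?thesis using h by (simp add: field_simps max_def)
  qed
  have "tooth V (x, y + 1) + tooth V (x, y - 1) = tooth V (x, s * (j + 1)) + tooth V (x, s * (j - 1))"
  proof -
    have "y + 1 = s * (j + 1) \<and> y - 1 = s * (j - 1) \<or> y + 1 = s * (j - 1) \<and> y - 1 = s * (j + 1)"
      using s ysj by auto
    then show ?thesis by (elim disjE conjE) (simp_all only: add.commute)
  qed
  then show ?thesis using conv j t[of "j + 1"] t[of "j - 1"] t[of j] ysj by simp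
qed

text \<open>
  The product of profile and tooth function is superharmonic: inside a tooth only the second factor
  varies, and at a spine site the two tooth neighbours together contribute the profile times
  \<open>2 - leak\<close>, so that the spine neighbours may contribute up to \<open>2 + leak\<close> times the profile.
\<close>
lemma prob_hit_le_profile:
  assumes fin: "finite V" and o: "(0, 0) \<in> V"
  shows "\<P>(\<omega> in comb_srw (0, 0). hit {(int R, 0)} \<omega> < hit (- V) \<omega>) \<le>
    1 / spine_growth (\<lambda>i. leak V (int i)) R"
proof -
  let ?w = "\<lambda>p. profile V R (fst p) * tooth V p"
  have "\<P>(\<omega> in comb_srw (0, 0). hit {(int R, 0)} \<omega> < hit (- V) \<omega>) \<le> ?w (0, 0)"
  proof (rule prob_hit_before_exit_le[OF fin o])
    show "0 \<le> ?w p" for p by (simp add: profile_nonneg tooth_def)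
    have "1 \<le> spine_growth (\<lambda>i. leak V (int i)) R"
      by (rule spine_growth_ge_1[OF leak_nonneg])
    then show "1 \<le> ?w (int R, 0)" by (simp add: profile_def tooth_def)
  next
    fix p assume pV: "p \<in> V" and pR: "p \<noteq> (int R, 0)"
    obtain x y where p: "p = (x, y)" by (cases p)
    show "(\<Sum>q | comb_adj p q. ?w q) \<le> real (card {q. comb_adj p q}) * ?w p"
    proof (cases "y = 0")
      case True
      have up: "tooth V (x, 1) = 1 - 1 / (real (arm V 1 x) + 1)"
        and down: "tooth V (x, -1) = 1 - 1 / (real (arm V (-1) x) + 1)"
        by (simp_all add: tooth_def field_simps)
      have "tooth V (x, 1) + tooth V (x, -1) = 2 - leak V x"
        by (simp add: up down leak_def)
      then have col: "profile V R x * tooth V (x, 1) + profile V R x * tooth V (x, -1) =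
          profile V R x * (2 - leak V x)"
        by (metis distrib_left)
      have base: "tooth V (i, 0) = 1" for i by (simp add: tooth_def)
      show ?thesis
        using profile_super[of x R V] pR col True
        by (simp add: p comb_nbrs base algebra_simps)
    next
      case False
      have "profile V R x * (tooth V (x, y + 1) + tooth V (x, y - 1)) \<le>
          profile V R x * (2 * tooth V (x, y))"
        using pV by (intro mult_left_mono tooth_super fin False profile_nonneg) (simp add: p)
      then show ?thesis using False by (simp add: p comb_nbrs algebra_simps)
    qed
  qed
  then show ?thesis by (simp add: profile_def tooth_def)
qed

text \<open>
  A site of the spine that is missing from \<open>V\<close> blocks the way: the indicator of the half-plane
  behind it is superharmonic on \<open>V\<close> and vanishes at the origin.
\<close>
lemma prob_hit_eq_0_of_gap:
  assumes fin: "finite V" and o: "(0, 0) \<in> V" and x: "0 < x" "x < int R" "(x, 0) \<notin> V"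
  shows "\<P>(\<omega> in comb_srw (0, 0). hit {(int R, 0)} \<omega> < hit (- V) \<omega>) = 0"
proof -
  let ?w = "\<lambda>p :: site. of_bool (x < fst p) :: real"
  have "\<P>(\<omega> in comb_srw (0, 0). hit {(int R, 0)} \<omega> < hit (- V) \<omega>) \<le> ?w (0, 0)"
  proof (rule prob_hit_before_exit_le[OF fin o])
    fix p assume pV: "p \<in> V"
    show "(\<Sum>q | comb_adj p q. ?w q) \<le> real (card {q. comb_adj p q}) * ?w p"
    proof (cases "x < fst p")
      case True
      then show ?thesis
        using sum_bounded_above[of "{q. comb_adj p q}" ?w 1] by (simp del: sum_of_bool_eq)
    next
      case False
      then have "fst p < x" if "snd p = 0"
        using that pV x(3) by (cases p) (auto simp: not_less le_less)
      with False have "?w q = 0" if "comb_adj p q" for q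
        using that by (auto simp: comb_adj_def)
      then show ?thesis by (simp del: sum_of_bool_eq)
    qed
  qed (use x in auto)
  also have "\<dots> = 0" using x by simp
  finally show ?thesis by (simp only: measure_le_0_iff)
qed

section \<open>The estimate\<close>

theorem lemma1p6:
  shows "\<exists>a\<^sub>3 \<kappa>\<^sub>3 :: real. a\<^sub>3 > 0 \<and> \<kappa>\<^sub>3 > 0 \<and>
    (\<forall>(R :: nat) (V :: (int \<times> int) set).
       R > 0 \<longrightarrow> (0, 0) \<in> V \<longrightarrow> (int R, 0) \<in> V \<longrightarrow>
       \<P>(\<omega> in comb_srw (0, 0). hit {(int R, 0)} \<omega> < hit (- V) \<omega>)
         \<le> exp (a\<^sub>3 - \<kappa>\<^sub>3 * sqrt (real R ^ 3 / real (card V))))"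
proof (rule exI[of _ 1], rule exI[of _ "1 / 64"], intro conjI allI impI)
  fix R :: nat and V :: "(int \<times> int) set"
  assume R: "R > 0" and o: "(0, 0) \<in> V" and tV: "(int R, 0) \<in> V"
  let ?P = "\<P>(\<omega> in comb_srw (0, 0). hit {(int R, 0)} \<omega> < hit (- V) \<omega>)"
  let ?v = "real (card V)"
  define s where "s = sqrt (real R ^ 3 / ?v)"
  interpret prob_space "comb_srw (0, 0)" by (rule prob_space_comb_srw)
  have trivial: "?P \<le> exp (1 - 1 / 64 * s)" if "s \<le> 64"
    using that by (intro order_trans[OF prob_le_1]) simp
  show "?P \<le> exp (1 - 1 / 64 * sqrt (real R ^ 3 / ?v))" unfolding s_def[symmetric]
  proof (cases "finite V \<and> (\<forall>i<R. (int i, 0) \<in> V)")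
    case False
    show "?P \<le> exp (1 - 1 / 64 * s)"
    proof (cases "finite V")
      case True
      with False obtain i where i: "i < R" "(int i, 0) \<notin> V" by blast
      with o have "i \<noteq> 0" by (intro notI) simp
      with i have "?P = 0" by (intro prob_hit_eq_0_of_gap[OF True o, of "int i"]) auto
      then show ?thesis by simp
    next
      \<comment> \<open>for infinite \<open>V\<close> the convention \<open>card V = 0\<close> makes the exponent \<open>s\<close> zero\<close>
      case inf: False
      then show ?thesis by (intro trivial) (simp add: s_def)
    qed
  next
    case True
    then have fin: "finite V" and spine: "\<And>i. i < R \<Longrightarrow> (int i, 0) \<in> V" by auto
    let ?k = "\<lambda>i. leak V (int i)"
    define c where "c i = real (arm V 1 (int i)) + real (arm V (-1) (int i)) + 1" for i :: nat
    have sum_c: "(\<Sum>i<n. c i) \<le> ?v" if "n \<le> R" for n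
      unfolding c_def using that by (intro sum_arms_le_card fin spine) auto
    have "real R \<le> (\<Sum>i<R. c i)"
      using sum_mono[of "{..<R}" "\<lambda>_. 1" c] by (simp add: c_def)
    with sum_c have Rv: "real R \<le> ?v" by (meson order_refl order_trans)
    \<comment> \<open>Block length: the factor \<open>8\<close> makes \<open>N\<close> blocks of length at least \<open>\<rho>\<close> that fill half of
      the spine satisfy \<open>card V \<le> N * L ^ 3 / 4\<close>.\<close>
    define \<rho> where "\<rho> = sqrt (8 * ?v / real R)"
    define L where "L = nat \<lceil>\<rho>\<rceil>"
    have \<rho>2: "\<rho>\<^sup>2 = 8 * ?v / real R" by (simp add: \<rho>_def)
    have "2\<^sup>2 \<le> \<rho>\<^sup>2" unfolding \<rho>2 using R Rv by (simp add: field_simps)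
    then have \<rho>: "2 \<le> \<rho>" by (rule power2_le_imp_le) (simp add: \<rho>_def)
    have L\<rho>: "\<rho> \<le> real L" "real L \<le> 2 * \<rho>" using \<rho> by (auto simp: L_def) linarith+
    have L: "2 \<le> L" using L\<rho> \<rho> by linarith
    have "s\<^sup>2 = real R ^ 3 / ?v" by (simp add: s_def)
    then have "s\<^sup>2 * \<rho>\<^sup>2 = 8 * (real R)\<^sup>2"
      unfolding \<rho>2 using R Rv by (simp add: power3_eq_cube power2_eq_square)
    also have "\<dots> \<le> (4 * real R)\<^sup>2" by (simp add: power_mult_distrib)
    finally have "(s * \<rho>)\<^sup>2 \<le> (4 * real R)\<^sup>2" by (simp add: power_mult_distrib)
    then have s\<rho>: "s * \<rho> \<le> 4 * real R" by (rule power2_le_imp_le) simp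
    show "?P \<le> exp (1 - 1 / 64 * s)"
    proof (cases "L \<le> R")
      \<comment> \<open>not even one block fits, so the exponent \<open>s\<close> is bounded\<close>
      case False
      then have "real R < 2 * \<rho>" using L\<rho> by linarith
      with s\<rho> have "s * \<rho> \<le> 8 * \<rho>" by linarith
      then show ?thesis using \<rho> by (intro trivial) simp
    next
      case True
      define N where "N = R div L"
      have NL: "N * L \<le> R" by (simp add: N_def)
      have "1 \<le> N" using True L by (simp add: N_def Suc_le_eq div_greater_zero_iff)
      moreover have "R < N * L + L"
        using L dividend_less_div_times[of L R] by (simp add: N_def)
      ultimately have "R \<le> 2 * N * L" using mult_le_mono1[of 1 N L] by linarith
      then have RN: "real R \<le> 2 * real N * real L" by (metis of_nat_le_iff of_nat_mult of_nat_numeral)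
      have "8 * ?v = real R * \<rho>\<^sup>2" using R by (simp add: \<rho>2)
      also have "\<dots> \<le> (2 * real N * real L) * (real L)\<^sup>2"
        using RN L\<rho> \<rho> by (intro mult_mono power_mono) auto
      finally have "?v \<le> real N / 4 * real L ^ 3"
        by (simp add: power3_eq_cube power2_eq_square mult_ac)
      then have "(\<Sum>i<N * L. c i) / real L ^ 3 \<le> real N / 4"
        using sum_c[OF NL] L by (simp add: pos_divide_le_eq)
      \<comment> \<open>the block bound yields the exponent \<open>N / 4\<close>, and \<open>N\<close> is at least \<open>s / 16\<close>\<close>
      moreover have "s * \<rho> \<le> 16 * real N * \<rho>"
        using s\<rho> RN mult_left_mono[OF L\<rho>(2), of "8 * real N"] by (simp add: algebra_simps)
      then have "s \<le> 16 * real N" using \<rho> by simp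
      ultimately have "exp (s / 64) \<le> exp (real N / 2 - (\<Sum>i<N * L. c i) / real L ^ 3)"
        by simp
      also have "\<dots> \<le> spine_growth ?k (N * L)"
        by (intro spine_growth_blocks[OF leak_nonneg] L) (simp_all add: c_def leak_ge)
      also have "\<dots> \<le> spine_growth ?k R"
        by (rule spine_growth_mono[OF leak_nonneg NL])
      finally have growth: "exp (s / 64) \<le> spine_growth ?k R" .
      have "?P \<le> 1 / spine_growth ?k R" by (rule prob_hit_le_profile[OF fin o])
      also have "\<dots> \<le> 1 / exp (s / 64)" using growth
        by (intro divide_left_mono mult_pos_pos less_le_trans[OF exp_gt_zero growth]) auto
      also have "\<dots> = exp (- (s / 64))" by (simp add: exp_minus field_simps)
      also have "\<dots> \<le> exp (1 - 1 / 64 * s)" by simp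
      finally show ?thesis .
    qed
  qed
qed simp_all

end
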